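(* Let $n=2$ or $n=3$, and let $P_1,P_2\in\mathbb{R}^{n\times n}$ be symmetric positive definite real matrices such that \[ \operatorname{tr}P_1\ge \operatorname{tr}P_2,\qquad \operatorname{tr}\operatorname{Cof}P_1\ge \operatorname{tr}\operatorname{Cof}P_2,\qquad \det P_1=\det P_2 . \] Then \[ \|\log P_1\|_F^2\ \ge\ \|\log P_2\|_F^2 . \]
   Context: $\operatorname{Cof}P$ denotes the cofactor matrix of $P$ (for invertible $P$, $\operatorname{Cof}P=\det(P)\,P^{-T}$). $\log$ denotes the principal matrix logarithm (for symmetric positive definite $P$, the unique real symmetric matrix $X$ with $\exp X=P$). $\|X\|_F^2=\sum_{i,j}X_{ij}^2$ is the squared Frobenius norm. *)

theory Defs
  imports "HOL-Analysis.Analysis"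
begin

definition symmetric_mat :: "real^'n^'n \<Rightarrow> bool" where
  "symmetric_mat A \<longleftrightarrow> transpose A = A"

definition spd_mat :: "real^'n^'n \<Rightarrow> bool" where
  "spd_mat A \<longleftrightarrow> symmetric_mat A \<and> (\<forall>x. x \<noteq> 0 \<longrightarrow> 0 < x \<bullet> (A *v x))"

text \<open>
  The \<open>(i, j)\<close> cofactor is the determinant of \<open>A\<close> with row \<open>i\<close> replaced by the \<open>j\<close>-th unit
  vector. By Laplace expansion this is the signed minor of \<open>A\<close>; the formulation needs
  no order on the index type. The lemma \<open>cof_mat_invertible\<close> gives the usual formula
  for invertible \<open>A\<close>.
\<close>

definition cof_mat :: "real^'n^'n \<Rightarrow> real^'n^'n" where
  "cof_mat A = (\<chi> i j. det (\<chi> r. if r = i then axis j 1 else A $ r))"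

lemma cof_mat_mult_transpose: "cof_mat A ** transpose A = det A *\<^sub>R mat 1"
proof -
  have "(cof_mat A ** transpose A) $ i $ k = (det A *\<^sub>R mat 1) $ i $ k" for i k
  proof -
    have "(cof_mat A ** transpose A) $ i $ k
        = (\<Sum>j\<in>UNIV. A $ k $ j * det (\<chi> r. if r = i then axis j 1 else A $ r))"
      by (simp add: matrix_matrix_mult_def cof_mat_def transpose_def mult.commute)
    also have "\<dots> = (\<Sum>j\<in>UNIV. det (\<chi> r. if r = i then A $ k $ j *s axis j 1 else A $ r))"
      by (simp add: det_row_mul)
    also have "\<dots> = det (\<chi> r. if r = i then (\<Sum>j\<in>UNIV. A $ k $ j *s axis j 1) else A $ r)"
      by (simp add: det_linear_row_sum)
    also have "\<dots> = det (\<chi> r. if r = i then A $ k else A $ r)"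
      by (subst basis_expansion) (rule refl)
    also have "\<dots> = (det A *\<^sub>R mat 1) $ i $ k"
    proof (cases "i = k")
      case True
      then have "(\<chi> r. if r = i then A $ k else A $ r) = A"
        by (simp add: vec_eq_iff)
      with True show ?thesis by (simp add: mat_def)
    next
      case False
      then have "det (\<chi> r. if r = i then A $ k else A $ r) = 0"
        by (intro det_identical_rows[of i k]) (auto simp: row_def vec_eq_iff)
      with False show ?thesis by (simp add: mat_def)
    qed
    finally show ?thesis .
  qed
  then show ?thesis by (simp add: vec_eq_iff)
qed

lemma cof_mat_invertible:
  assumes "invertible A"
  shows "cof_mat A = det A *\<^sub>R transpose (matrix_inv A)"
proof -
  have "matrix_inv A ** A = mat 1"
    using assms someI_ex[of "\<lambda>B. A ** B = mat 1 \<and> B ** A = mat 1"]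
    by (simp add: invertible_def matrix_inv_def)
  then have inv: "transpose A ** transpose (matrix_inv A) = mat 1"
    by (metis matrix_transpose_mul transpose_mat)
  have "cof_mat A = (cof_mat A ** transpose A) ** transpose (matrix_inv A)"
    by (simp add: inv flip: matrix_mul_assoc)
  also have "\<dots> = det A *\<^sub>R transpose (matrix_inv A)"
    by (simp add: cof_mat_mult_transpose flip: scalar_matrix_assoc)
  finally show ?thesis .
qed

text \<open>
  The type \<^typ>\<open>real^'n^'n\<close> carries componentwise \<open>*\<close>, \<open>1\<close> and \<open>^\<close>, and it is not an
  instance of the class on which \<open>exp\<close> is defined; hence powers with respect to the matrix
  product \<open>**\<close> and the exponential series are written out.
\<close>

definition mat_pow :: "real^'n^'n \<Rightarrow> nat \<Rightarrow> real^'n^'n" where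
  "mat_pow A k = (((**) A) ^^ k) (mat 1)"

definition mat_exp :: "real^'n^'n \<Rightarrow> real^'n^'n" where
  "mat_exp A = (\<Sum>k. (1 / fact k) *\<^sub>R mat_pow A k)"

text \<open>
  Meaningful for symmetric positive definite \<open>P\<close>, where exactly one such \<open>X\<close> exists.
\<close>

definition mat_log :: "real^'n^'n \<Rightarrow> real^'n^'n" where
  "mat_log P = (THE X. symmetric_mat X \<and> mat_exp X = P)"

definition frobenius_sq :: "real^'n^'n \<Rightarrow> real" where
  "frobenius_sq X = (\<Sum>i\<in>UNIV. \<Sum>j\<in>UNIV. (X $ i $ j)\<^sup>2)"

lemma frobenius_sq_eq_norm: "frobenius_sq X = (norm X)\<^sup>2"
  by (simp add: frobenius_sq_def norm_vec_def L2_set_def sum_nonneg)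

end

theory Submission
  imports Defs
begin

text \<open>
  A positive definite matrix with eigenvalues \<open>a\<^sub>i\<close> has a logarithm with eigenvalues \<open>ln a\<^sub>i\<close>, so
  the claim compares \<open>\<Sum>(ln a\<^sub>i)\<^sup>2\<close> with \<open>\<Sum>(ln b\<^sub>i)\<^sup>2\<close> for the eigenvalues of the two matrices.
  The hypotheses on trace, cofactor trace and determinant say that the elementary symmetric
  polynomials of \<open>a\<close> dominate those of \<open>b\<close>, with equality in top degree. Since these are the
  coefficients of \<open>p(t) = \<Prod>(t + a\<^sub>i)\<close> and \<open>q(t) = \<Prod>(t + b\<^sub>i)\<close>, it follows that \<open>p(t) \<ge> q(t)\<close>
  for \<open>t \<ge> 0\<close> and \<open>p(0) = q(0)\<close>. Both matter in the identity

    \<open>\<integral>\<^sub>0\<^sup>\<infinity> ln (p(t) / q(t)) / t dt = (\<Sum>(ln a\<^sub>i)\<^sup>2 - \<Sum>(ln b\<^sub>i)\<^sup>2) / 2\<close>,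

  whose integrand is nonnegative; equality at \<open>0\<close> makes the integral converge there.

  The identity is proved one eigenvalue at a time, with the integral cut off to \<open>[1/N, N]\<close>. For
  a single number \<open>a > 0\<close>, the function \<open>K\<^sub>N(a) = \<integral> ln (t + a) / t dt\<close> diverges as \<open>N \<rightarrow> \<infinity>\<close>, but
  \<open>K\<^sub>N(a) - K\<^sub>N(1) - ln N * ln a\<close> tends to \<open>(ln a)\<^sup>2 / 2\<close> (lemma \<open>log_shift_integral_limit\<close>).
  Summed over the eigenvalues, the divergent terms \<open>ln N * ln a\<^sub>i\<close> only see the determinant
  and cancel between the two matrices. This gives \<open>sum_ln_squared_mono\<close>, which holds for any
  number of eigenvalues; the dimension enters only through \<open>prod_shift_mono_dim_2_3\<close>, because
  for \<open>n = 2\<close> and \<open>n = 3\<close> trace, cofactor trace and determinant exhaust the coefficients of \<open>p\<close>.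

  The matrix side rests on the spectral theorem \<open>symmetric_mat_spectral\<close> and on
  \<open>mat_log_spectral_mat\<close>, which identifies the logarithm in an orthonormal eigenbasis.
\<close>

section \<open>Squared logarithms as an integral of logarithms of shifted products\<close>

text \<open>
  The integrand is the derivative of \<open>ln (t + a) / t\<close> with respect to \<open>a\<close>. The value is arranged so
  that the divergent part \<open>ln N / a\<close> stands apart from terms that converge as \<open>N \<rightarrow> \<infinity>\<close>.
\<close>

lemma has_integral_inverse_shifted:
  fixes a N :: real
  assumes "a > 0" "N \<ge> 1"
  shows "((\<lambda>t. 1 / (t * (t + a))) has_integral
            (ln N + ln (a + 1 / N) - ln (1 + a / N)) / a) {1 / N..N}"
proof -
  have le: "1 / N \<le> N"
    using assms(2) by (smt (verit) divide_le_eq_1 mult_left_le)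
  have "((\<lambda>t. 1 / (t * (t + a))) has_integral
          ((ln N - ln (N + a)) / a - (ln (1 / N) - ln (1 / N + a)) / a)) {1 / N..N}"
  proof (rule fundamental_theorem_of_calculus[OF le])
    fix t assume "t \<in> {1 / N..N}"
    then have "t > 0"
      using assms by (auto intro: less_le_trans[rotated])
    with assms show "((\<lambda>t. (ln t - ln (t + a)) / a) has_vector_derivative 1 / (t * (t + a)))
        (at t within {1 / N..N})"
      unfolding has_real_derivative_iff_has_vector_derivative[symmetric]
      by (auto intro!: derivative_eq_intros simp: divide_simps)
  qed
  moreover have "(ln N - ln (N + a)) / a - (ln (1 / N) - ln (1 / N + a)) / a
      = (ln N + ln (a + 1 / N) - ln (1 + a / N)) / a"
  proof -
    have "N + a = N * (1 + a / N)"
      using assms by (simp add: field_simps)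
    moreover have "1 + a / N > 0"
      using assms by (simp add: add_pos_pos)
    ultimately have "ln (N + a) = ln N + ln (1 + a / N)"
      using assms by (simp add: ln_mult_pos)
    moreover have "ln (1 / N) = - ln N"
      using assms by (simp add: ln_div)
    ultimately show ?thesis
      by (simp add: add.commute[of a] diff_divide_distrib add_divide_distrib)
  qed
  ultimately show ?thesis
    by simp
qed

definition log_shift_integral :: "real \<Rightarrow> real \<Rightarrow> real" where
  "log_shift_integral N a = integral {1 / N..N} (\<lambda>t. ln (t + a) / t)"

lemma integrable_log_shift:
  fixes a N :: real
  assumes "a > 0" "N > 0"
  shows "(\<lambda>t. ln (t + a) / t) integrable_on {1 / N..N}"
proof (rule integrable_continuous_interval)
  have "t > 0" if "t \<in> {1 / N..N}" for t
    using that assms by (auto intro: less_le_trans[rotated])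
  then show "continuous_on {1 / N..N} (\<lambda>t. ln (t + a) / t)"
    using assms by (intro continuous_intros) (force simp: add_pos_pos)+
qed

lemma log_shift_integral_deriv:
  fixes a N :: real
  assumes "a > 0" "N \<ge> 1"
  shows "(log_shift_integral N has_field_derivative
            (ln N + ln (a + 1 / N) - ln (1 + a / N)) / a) (at a)"
proof -
  have pos: "t > 0" if "t \<in> {1 / N..N}" for t
    using that assms by (auto intro: less_le_trans[rotated])
  have "((\<lambda>x. integral (cbox (1 / N) N) (\<lambda>t. ln (t + x) / t)) has_field_derivative
          integral (cbox (1 / N) N) (\<lambda>t. 1 / (t * (t + a)))) (at a within {0<..})"
  proof (rule leibniz_rule_field_derivative)
    show "((\<lambda>x. ln (t + x) / t) has_field_derivative 1 / (t * (t + x))) (at x within {0<..})"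
      if "x \<in> {0<..}" "t \<in> cbox (1 / N) N" for x t
    proof -
      have "x > 0" "t > 0"
        using that pos by auto
      then show ?thesis
        by (auto intro!: derivative_eq_intros simp: divide_simps)
    qed
    show "(\<lambda>t. ln (t + x) / t) integrable_on cbox (1 / N) N" if "x \<in> {0<..}" for x
      using that assms integrable_log_shift[of x N] by simp
    show "continuous_on ({0<..} \<times> cbox (1 / N) N) (\<lambda>(x, t). 1 / (t * (t + x)))"
      unfolding split_beta
    proof (intro continuous_intros ballI)
      fix p :: "real \<times> real" assume "p \<in> {0<..} \<times> cbox (1 / N) N"
      then have "fst p > 0" "snd p > 0"
        using pos by auto
      then show "snd p * (snd p + fst p) \<noteq> 0"
        by simp
    qed
  qed (use assms in auto)
  moreover have "integral (cbox (1 / N) N) (\<lambda>t. 1 / (t * (t + a)))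
      = (ln N + ln (a + 1 / N) - ln (1 + a / N)) / a"
    using has_integral_inverse_shifted[OF assms] by (simp add: integral_unique)
  moreover have "at a within {0<..} = at a"
    using assms by (intro at_within_open) auto
  ultimately show ?thesis
    unfolding log_shift_integral_def[abs_def] by simp
qed

text \<open>
  By \<open>log_shift_integral_deriv\<close> the expression, as a function of \<open>a\<close>, has derivative
  \<open>(ln (1 + 1 / (a * N)) - ln (1 + a / N)) / a\<close>, because \<open>ln N * ln a\<close> and \<open>(ln a)\<^sup>2 / 2\<close> remove
  exactly the part of the derivative that does not vanish for large \<open>N\<close>. What is left is \<open>O(1 / N)\<close>
  uniformly on \<open>{m..}\<close>, and the expression is \<open>0\<close> at \<open>a = 1\<close>, so the mean value inequality applies.
\<close>

lemma log_shift_integral_asymptotics: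
  fixes a N :: real
  assumes "a > 0" "N \<ge> 1"
  defines "m \<equiv> min 1 a"
  shows "\<bar>log_shift_integral N a - log_shift_integral N 1 - ln N * ln a - (ln a)\<^sup>2 / 2\<bar>
           \<le> (1 + 1 / m\<^sup>2) / N * \<bar>a - 1\<bar>"
proof -
  define D where "D x = log_shift_integral N x - ln N * ln x - (ln x)\<^sup>2 / 2" for x
  have m: "m > 0" using assms by (simp add: m_def)
  have "norm (D a - D 1) \<le> (1 + 1 / m\<^sup>2) / N * norm (a - 1)"
  proof (rule field_differentiable_bound[where S = "{m..}"])
    fix x assume "x \<in> {m..}"
    then have x: "x \<ge> m" "x > 0" using m by auto
    have ln_split: "ln (x + 1 / N) = ln x + ln (1 + 1 / (x * N))"
    proof -
      have "x + 1 / N = x * (1 + 1 / (x * N))"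
        using x assms by (simp add: field_simps)
      moreover have "1 + 1 / (x * N) > 0"
        using x assms by (simp add: add_pos_pos)
      ultimately show ?thesis
        using x by (metis ln_mult_pos)
    qed
    show "(D has_field_derivative (ln (1 + 1 / (x * N)) - ln (1 + x / N)) / x) (at x within {m..})"
      unfolding D_def[abs_def] using x assms
      by (auto intro!: derivative_eq_intros has_field_derivative_at_within[OF log_shift_integral_deriv]
               simp: ln_split add_divide_distrib diff_divide_distrib)
    have "0 \<le> ln (1 + 1 / (x * N))" "ln (1 + 1 / (x * N)) \<le> 1 / (x * N)"
         "0 \<le> ln (1 + x / N)" "ln (1 + x / N) \<le> x / N"
      using x assms by (auto intro!: ln_add_one_self_le_self ln_ge_zero)
    moreover from x assms have "0 \<le> 1 / (x * N)" "0 \<le> x / N" by auto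
    ultimately have "\<bar>ln (1 + 1 / (x * N)) - ln (1 + x / N)\<bar> \<le> 1 / (x * N) + x / N"
      by linarith
    then have "\<bar>ln (1 + 1 / (x * N)) - ln (1 + x / N)\<bar> / x \<le> (1 / (x * N) + x / N) / x"
      using x by (intro divide_right_mono) auto
    also have "\<dots> = (1 + 1 / x\<^sup>2) / N"
      using x assms by (simp add: field_simps power2_eq_square)
    also have "\<dots> \<le> (1 + 1 / m\<^sup>2) / N"
      using x m assms by (intro divide_right_mono add_left_mono divide_left_mono power_mono mult_pos_pos) auto
    finally show "norm ((ln (1 + 1 / (x * N)) - ln (1 + x / N)) / x) \<le> (1 + 1 / m\<^sup>2) / N"
      using x by simp
  qed (auto simp: m_def)
  then show ?thesis
    by (simp add: D_def algebra_simps)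
qed

lemma log_shift_integral_limit:
  fixes a :: real
  assumes "a > 0"
  shows "((\<lambda>N. log_shift_integral N a - log_shift_integral N 1 - ln N * ln a) \<longlongrightarrow> (ln a)\<^sup>2 / 2) at_top"
proof (rule LIM_zero_cancel, rule Lim_null_comparison)
  let ?C = "(1 + 1 / (min 1 a)\<^sup>2) * \<bar>a - 1\<bar>"
  show "\<forall>\<^sub>F N in at_top. norm (log_shift_integral N a - log_shift_integral N 1 - ln N * ln a - (ln a)\<^sup>2 / 2)
          \<le> ?C / N"
    using eventually_ge_at_top[of 1]
    by eventually_elim (use log_shift_integral_asymptotics[OF assms] in simp)
  show "((\<lambda>N. ?C / N) \<longlongrightarrow> 0) at_top"
    by (rule tendsto_divide_0[OF tendsto_const filterlim_at_top_imp_at_infinity[OF filterlim_ident]])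
qed

text \<open>
  The renormalized integrals \<open>R N\<close> have the limit \<open>(ln x)\<^sup>2 / 2\<close>, so it suffices to compare their sums
  for fixed \<open>N\<close>. There the subtracted terms agree on both sides since \<open>\<Sum>ln a\<^sub>i = \<Sum>ln b\<^sub>i\<close>, and the
  integrals are ordered since their integrands \<open>ln \<Prod>(t + b\<^sub>i) / t\<close> and \<open>ln \<Prod>(t + a\<^sub>i) / t\<close> are.
\<close>

lemma sum_ln_squared_mono:
  fixes a b :: "'i \<Rightarrow> real"
  assumes a: "\<And>i. i \<in> I \<Longrightarrow> a i > 0" and b: "\<And>i. i \<in> I \<Longrightarrow> b i > 0"
    and prod_le: "\<And>t. t > 0 \<Longrightarrow> (\<Prod>i\<in>I. t + b i) \<le> (\<Prod>i\<in>I. t + a i)"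
    and prod_eq: "prod b I = prod a I"
  shows "(\<Sum>i\<in>I. (ln (b i))\<^sup>2) \<le> (\<Sum>i\<in>I. (ln (a i))\<^sup>2)"
proof (cases "finite I")
  case True
  have a': "\<forall>i\<in>I. a i > 0" and b': "\<forall>i\<in>I. b i > 0"
    using a b by auto
  define R where "R N x = log_shift_integral N x - log_shift_integral N 1 - ln N * ln x" for N x
  have R_lim: "((\<lambda>N. \<Sum>i\<in>I. R N (c i)) \<longlongrightarrow> (\<Sum>i\<in>I. (ln (c i))\<^sup>2 / 2)) at_top"
    if "\<And>i. i \<in> I \<Longrightarrow> c i > 0" for c
    unfolding R_def by (intro tendsto_sum log_shift_integral_limit that)
  have ln_prod_shift: "(\<Sum>i\<in>I. ln (t + c i)) = ln (\<Prod>i\<in>I. t + c i)"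
    if "\<And>i. i \<in> I \<Longrightarrow> c i > 0" "t \<ge> 0" for t and c :: "'i \<Rightarrow> real"
    using that True by (intro ln_prod[symmetric]) (force simp: add_nonneg_pos)+
  have sum_ln: "(\<Sum>i\<in>I. ln (b i)) = (\<Sum>i\<in>I. ln (a i))"
    using ln_prod_shift[OF a, where t = 0] ln_prod_shift[OF b, where t = 0] prod_eq by simp
  have "(\<Sum>i\<in>I. R N (b i)) \<le> (\<Sum>i\<in>I. R N (a i))" if N: "N \<ge> 1" for N
  proof -
    have int: "(\<lambda>t. \<Sum>i\<in>I. ln (t + c i) / t) integrable_on {1 / N..N}"
      and eq: "(\<Sum>i\<in>I. log_shift_integral N (c i)) = integral {1 / N..N} (\<lambda>t. \<Sum>i\<in>I. ln (t + c i) / t)"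
      if "\<forall>i\<in>I. c i > 0" for c
      unfolding log_shift_integral_def using that N True
      by (auto intro!: integrable_sum integral_sum[symmetric] integrable_log_shift)
    have "(\<Sum>i\<in>I. log_shift_integral N (b i)) \<le> (\<Sum>i\<in>I. log_shift_integral N (a i))"
      unfolding eq[of a, OF a'] eq[of b, OF b']
    proof (rule integral_le[OF int[of b, OF b'] int[of a, OF a']])
      fix t assume "t \<in> {1 / N..N}"
      then have t: "t > 0"
        using N by (auto intro: less_le_trans[rotated])
      have "ln (\<Prod>i\<in>I. t + b i) \<le> ln (\<Prod>i\<in>I. t + a i)"
        using prod_le[OF t] b t by (intro ln_mono prod_pos) (auto intro: add_pos_pos)
      then have "(\<Sum>i\<in>I. ln (t + b i)) \<le> (\<Sum>i\<in>I. ln (t + a i))"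
        using t ln_prod_shift[of a t, OF a] ln_prod_shift[of b t, OF b] by simp
      then show "(\<Sum>i\<in>I. ln (t + b i) / t) \<le> (\<Sum>i\<in>I. ln (t + a i) / t)"
        using t by (simp add: divide_right_mono flip: sum_divide_distrib)
    qed
    then show ?thesis
      using sum_ln by (simp add: R_def sum_subtractf flip: sum_distrib_left)
  qed
  then have "\<forall>\<^sub>F N in at_top. (\<Sum>i\<in>I. R N (b i)) \<le> (\<Sum>i\<in>I. R N (a i))"
    by (rule eventually_mono[OF eventually_ge_at_top])
  then have "(\<Sum>i\<in>I. (ln (b i))\<^sup>2 / 2) \<le> (\<Sum>i\<in>I. (ln (a i))\<^sup>2 / 2)"
    by (intro tendsto_le[OF trivial_limit_at_top_linorder R_lim R_lim] a b)
  then show ?thesis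
    by (simp flip: sum_divide_distrib)
next
  case False
  then show ?thesis
    by (simp add: sum.infinite[OF False])
qed

section \<open>Orthogonal diagonalization of real symmetric matrices\<close>

lemma symmetric_mat_inner:
  fixes A :: "real^'n^'n"
  assumes "symmetric_mat A"
  shows "x \<bullet> (A *v y) = (A *v x) \<bullet> y"
  using assms by (metis dot_lmul_matrix symmetric_mat_def vector_transpose_matrix)

text \<open>
  A maximizer \<open>u\<close> of the quadratic form of \<open>A\<close> on the unit sphere of \<open>S\<close>, with maximum \<open>c\<close>, is an
  eigenvector: the form \<open>q x = c * (x \<bullet> x) - x \<bullet> (A *v x)\<close> is nonnegative on \<open>S\<close> and vanishes at
  \<open>u\<close>, so its first-order term at \<open>u\<close> must vanish in every direction of \<open>S\<close>. Invariance of \<open>S\<close>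
  makes the residual \<open>w = c *\<^sub>R u - A *v u\<close> such a direction, and there the first-order term is
  a multiple of \<open>w \<bullet> w\<close>.
\<close>

lemma invariant_subspace_eigenvector:
  fixes A :: "real^'n^'n"
  assumes A: "symmetric_mat A"
    and S: "subspace S" "S \<noteq> {0}" and inv: "\<And>x. x \<in> S \<Longrightarrow> A *v x \<in> S"
  obtains u c where "u \<in> S" "norm u = 1" "A *v u = c *\<^sub>R u"
proof -
  obtain z where z: "z \<in> S" "z \<noteq> 0"
    using S subspace_0 by auto
  let ?K = "sphere 0 1 \<inter> S"
  have "compact ?K"
    by (intro compact_Int_closed closed_subspace S) simp
  moreover have "z /\<^sub>R norm z \<in> ?K"
    using z S by (simp add: subspace_scale)
  moreover have "continuous_on ?K (\<lambda>x. x \<bullet> (A *v x))"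
    by (intro continuous_intros matrix_vector_mult_linear_continuous_on)
  ultimately obtain u where u: "u \<in> ?K" and max: "\<And>x. x \<in> ?K \<Longrightarrow> x \<bullet> (A *v x) \<le> u \<bullet> (A *v u)"
    using continuous_attains_sup[of ?K "\<lambda>x. x \<bullet> (A *v x)"] by blast
  define c where "c = u \<bullet> (A *v u)"
  define w where "w = c *\<^sub>R u - A *v u"
  define q where "q x = c * (x \<bullet> x) - x \<bullet> (A *v x)" for x
  have w: "w \<in> S"
    using u inv S unfolding w_def by (auto intro: subspace_diff subspace_scale)
  have q_nonneg: "q x \<ge> 0" if "x \<in> S" for x
  proof (cases "x = 0")
    case False
    then have "(x /\<^sub>R norm x) \<bullet> (A *v (x /\<^sub>R norm x)) \<le> c"
      unfolding c_def using that S by (intro max) (simp add: subspace_scale)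
    then have "(x \<bullet> (A *v x)) / (norm x)\<^sup>2 \<le> c"
      by (simp add: matrix_vector_mult_scaleR power2_eq_square divide_inverse mult.commute mult.left_commute)
    with False show ?thesis
      by (simp add: q_def dot_square_norm field_simps)
  qed (simp add: q_def)
  have q_line: "q (u - s *\<^sub>R w) = s * (s * q w - 2 * (w \<bullet> w))" for s
  proof -
    have uu: "u \<bullet> u = 1"
      using u by (simp add: dot_square_norm)
    have uw: "u \<bullet> (A *v w) = w \<bullet> (A *v u)"
      using symmetric_mat_inner[OF A, of u w] by (simp add: inner_commute)
    have "A *v u = c *\<^sub>R u - w"
      by (simp add: w_def)
    then have wu: "w \<bullet> (A *v u) = c * (u \<bullet> w) - w \<bullet> w"
      by (simp add: inner_diff_right inner_commute)
    have expand: "q (u - s *\<^sub>R w)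
        = c * (u \<bullet> u - 2 * s * (u \<bullet> w) + s * s * (w \<bullet> w))
          - (c - s * (u \<bullet> (A *v w)) - s * (w \<bullet> (A *v u)) + s * s * (w \<bullet> (A *v w)))"
      by (simp add: q_def c_def matrix_vector_mult_diff_distrib matrix_vector_mult_scaleR
          inner_diff_left inner_diff_right inner_commute[of w u] algebra_simps)
    show ?thesis
      unfolding expand unfolding uu uw wu q_def by (simp add: algebra_simps)
  qed
  have "w \<bullet> w = 0"
  proof (rule ccontr)
    assume "w \<bullet> w \<noteq> 0"
    then have ww: "w \<bullet> w > 0" by (simp add: inner_gt_zero_iff)
    \<comment> \<open>A step so short that the quadratic term \<open>s * q w\<close> cannot outweigh the linear one;
      the \<open>1\<close> in the denominator covers \<open>q w = 0\<close>.\<close>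
    define s where "s = (w \<bullet> w) / (1 + q w)"
    have qw: "q w \<ge> 0" using q_nonneg w by blast
    then have s: "s > 0" "s * q w \<le> w \<bullet> w"
      using ww by (auto simp: s_def field_simps)
    have "q (u - s *\<^sub>R w) \<ge> 0"
      using u w S by (intro q_nonneg) (auto intro: subspace_diff subspace_scale)
    with s ww show False
      unfolding q_line by (smt (verit) mult_pos_neg)
  qed
  then have "A *v u = c *\<^sub>R u" by (simp add: w_def)
  with u that show ?thesis by auto
qed

text \<open>
  An orthonormal set of eigenvectors of largest cardinality is a basis: otherwise its orthogonal
  complement is a nonzero invariant subspace and contributes one more eigenvector.
\<close>

lemma orthonormal_eigenbasis:
  fixes A :: "real^'n^'n"
  assumes A: "symmetric_mat A"
  obtains B where "pairwise orthogonal B" "\<And>x. x \<in> B \<Longrightarrow> norm x = 1" "card B = CARD('n)" "finite B"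
    "\<And>x. x \<in> B \<Longrightarrow> \<exists>c. A *v x = c *\<^sub>R x"
proof -
  define good where "good B \<longleftrightarrow> pairwise orthogonal B \<and> (\<forall>x\<in>B. norm x = 1 \<and> (\<exists>c. A *v x = c *\<^sub>R x))"
    for B
  have indep: "independent B" if "good B" for B
    using that by (intro pairwise_orthogonal_independent) (auto simp: good_def)
  have bound: "finite B \<and> card B \<le> CARD('n)" if "good B" for B
    using independent_bound[OF indep[OF that]] by simp
  have "good {}" by (simp add: good_def)
  then obtain B where B: "good B" and max: "\<And>B'. good B' \<Longrightarrow> card B' \<le> card B"
    using ex_has_greatest_nat[of good "{}" card "Suc CARD('n)"] bound by (metis less_Suc_eq_le)
  have "card B = CARD('n)"
  proof (rule ccontr)
    assume "card B \<noteq> CARD('n)"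
    then have "dim B < CARD('n)"
      using bound[OF B] dim_eq_card_independent[OF indep[OF B]] by simp
    define S where "S = {y. \<forall>x\<in>B. orthogonal x y}"
    have "subspace S"
      by (auto simp: S_def subspace_def orthogonal_clauses)
    moreover obtain y where y: "y \<noteq> 0" "\<And>x. x \<in> span B \<Longrightarrow> orthogonal y x"
      using orthogonal_to_subspace_exists[of B] \<open>dim B < CARD('n)\<close> by auto
    moreover have "y \<in> S"
      unfolding S_def using y(2) span_base orthogonal_commute by blast
    moreover have "A *v y \<in> S" if "y \<in> S" for y
      unfolding S_def
    proof safe
      fix x assume x: "x \<in> B"
      then obtain c where "A *v x = c *\<^sub>R x" using B by (auto simp: good_def)
      moreover have "x \<bullet> y = 0" using x that by (auto simp: S_def orthogonal_def)
      ultimately show "orthogonal x (A *v y)"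
        by (simp add: orthogonal_def symmetric_mat_inner[OF A])
    qed
    ultimately obtain u c where u: "u \<in> S" "norm u = 1" "A *v u = c *\<^sub>R u"
      using invariant_subspace_eigenvector[OF A, of S] by blast
    have "u \<notin> B"
      using u by (auto simp: S_def orthogonal_def)
    moreover have "good (insert u B)"
      using B u orthogonal_commute unfolding good_def pairwise_insert S_def by blast
    ultimately show False
      using max[of "insert u B"] bound[OF B] by simp
  qed
  with B bound[OF B] show ?thesis
    by (intro that[of B]) (auto simp: good_def)
qed

definition diag_mat :: "('n \<Rightarrow> real) \<Rightarrow> real^'n^'n" where
  "diag_mat f = (\<chi> i j. if i = j then f i else 0)"

definition spectral_mat :: "real^'n^'n \<Rightarrow> ('n \<Rightarrow> real) \<Rightarrow> real^'n^'n" where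
  "spectral_mat Q f = Q ** diag_mat f ** transpose Q"

lemma mult_diag_mat: "(A ** diag_mat f) $ i $ j = A $ i $ j * f j"
  by (simp add: matrix_matrix_mult_def diag_mat_def if_distrib cong: if_cong)

lemma diag_mat_mult: "(diag_mat f ** A) $ i $ j = f i * A $ i $ j"
  by (simp add: matrix_matrix_mult_def diag_mat_def if_distrib[of "\<lambda>x. x * _"] cong: if_cong)

lemma spectral_mat_nth: "spectral_mat Q f $ i $ j = (\<Sum>l\<in>UNIV. Q $ i $ l * f l * Q $ j $ l)"
  unfolding spectral_mat_def matrix_matrix_mult_def[of "Q ** diag_mat f"]
  by (simp add: mult_diag_mat transpose_def)

theorem symmetric_mat_spectral:
  fixes A :: "real^'n^'n"
  assumes "symmetric_mat A"
  obtains Q d where "orthogonal_matrix Q" "A = spectral_mat Q d"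
proof -
  obtain B where B: "pairwise orthogonal B" "\<And>x. x \<in> B \<Longrightarrow> norm x = 1" "card B = CARD('n)" "finite B"
    and eig: "\<And>x. x \<in> B \<Longrightarrow> \<exists>c. A *v x = c *\<^sub>R x"
    using orthonormal_eigenbasis[OF assms] by blast
  obtain v where v: "bij_betw v (UNIV :: 'n set) B"
    using finite_same_card_bij[of "UNIV :: 'n set" B] B by auto
  then have vB: "v l \<in> B" for l
    by (auto simp: bij_betw_def)
  define Q where "Q = (\<chi> i l. v l $ i)"
  obtain d where d: "\<And>l. A *v v l = d l *\<^sub>R v l"
    using eig[OF vB] by metis
  have col: "column l Q = v l" for l
    by (simp add: column_def Q_def vec_eq_iff)
  have "orthogonal_matrix Q"
    unfolding orthogonal_matrix_orthonormal_columns col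
  proof (intro conjI allI impI)
    fix i j :: 'n assume "i \<noteq> j"
    then have "v i \<noteq> v j" using v by (auto simp: bij_betw_def inj_on_def)
    with B vB show "orthogonal (v i) (v j)" by (auto simp: pairwise_def)
  qed (use B vB in auto)
  moreover have "A ** Q = Q ** diag_mat d"
  proof -
    have "(A ** Q) $ i $ l = (A *v v l) $ i" for i l
      by (simp add: matrix_matrix_mult_def matrix_vector_mult_def Q_def)
    then show ?thesis
      by (simp add: vec_eq_iff mult_diag_mat d Q_def)
  qed
  ultimately have "A = spectral_mat Q d"
    by (metis matrix_mul_assoc matrix_mul_rid orthogonal_matrix_def spectral_mat_def)
  with \<open>orthogonal_matrix Q\<close> show ?thesis by (rule that)
qed

section \<open>Functions of a diagonalized matrix\<close>

lemma symmetric_spectral_mat: "symmetric_mat (spectral_mat Q f)"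
  by (simp add: symmetric_mat_def vec_eq_iff transpose_def spectral_mat_nth mult_ac)

lemma spectral_mat_mult:
  assumes "orthogonal_matrix Q"
  shows "spectral_mat Q f ** spectral_mat Q g = spectral_mat Q (\<lambda>i. f i * g i)"
proof -
  have "spectral_mat Q f ** spectral_mat Q g
      = Q ** (diag_mat f ** (transpose Q ** Q) ** diag_mat g) ** transpose Q"
    by (simp add: spectral_mat_def matrix_mul_assoc)
  moreover have "diag_mat f ** diag_mat g = diag_mat (\<lambda>i. f i * g i)"
    by (simp add: vec_eq_iff diag_mat_mult) (simp add: diag_mat_def)
  ultimately show ?thesis
    using assms by (simp add: spectral_mat_def orthogonal_matrix_def)
qed

lemma spectral_mat_one:
  fixes Q :: "real^'n^'n"
  assumes "orthogonal_matrix Q"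
  shows "spectral_mat Q (\<lambda>_. 1) = mat 1"
proof -
  have "diag_mat (\<lambda>_. 1) = (mat 1 :: real^'n^'n)"
    by (simp add: diag_mat_def mat_def)
  then show ?thesis
    using assms by (simp add: spectral_mat_def orthogonal_matrix_def)
qed

lemma trace_spectral_mat:
  assumes "orthogonal_matrix Q"
  shows "trace (spectral_mat Q f) = sum f UNIV"
proof -
  have "trace (spectral_mat Q f) = trace (transpose Q ** Q ** diag_mat f)"
    unfolding spectral_mat_def by (metis trace_mul_sym matrix_mul_assoc)
  then show ?thesis
    using assms by (simp add: orthogonal_matrix_def trace_def diag_mat_def)
qed

lemma det_spectral_mat:
  assumes "orthogonal_matrix Q"
  shows "det (spectral_mat Q f) = prod f UNIV"
proof -
  have "det Q * det Q = 1"
    using det_orthogonal_matrix[OF assms] by auto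
  moreover have "det (diag_mat f) = prod f UNIV"
    by (subst det_diagonal) (simp_all add: diag_mat_def)
  ultimately show ?thesis
    by (simp add: spectral_mat_def det_mul det_transpose mult_ac)
qed

text \<open>
  The cofactor matrix of an invertible symmetric matrix is its determinant times its inverse. The
  right-hand side is the elementary symmetric polynomial of degree \<open>n - 1\<close> in \<open>f\<close>, written
  without reference to an order on the index type.
\<close>

lemma trace_cof_spectral_mat:
  fixes Q :: "real^'n^'n"
  assumes Q: "orthogonal_matrix Q" and f: "\<And>i. f i \<noteq> 0"
  shows "trace (cof_mat (spectral_mat Q f)) = prod f UNIV * (\<Sum>i\<in>UNIV. 1 / f i)"
proof -
  let ?P = "spectral_mat Q f" and ?P' = "spectral_mat Q (\<lambda>i. 1 / f i)"
  have "cof_mat ?P ** (?P ** ?P') = det ?P *\<^sub>R ?P'"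
    using cof_mat_mult_transpose[of ?P] symmetric_spectral_mat[of Q f]
    by (simp add: symmetric_mat_def matrix_mul_assoc flip: scalar_matrix_assoc)
  then have "cof_mat ?P = det ?P *\<^sub>R ?P'"
    using f by (simp add: spectral_mat_mult[OF Q] spectral_mat_one[OF Q])
  moreover have "trace (c *\<^sub>R X) = c * trace X" for c and X :: "real^'n^'n"
    by (simp add: trace_def sum_distrib_left)
  ultimately show ?thesis
    by (simp add: trace_spectral_mat[OF Q] det_spectral_mat[OF Q])
qed

lemma frobenius_sq_spectral_mat:
  fixes Q :: "real^'n^'n"
  assumes "orthogonal_matrix Q"
  shows "frobenius_sq (spectral_mat Q f) = (\<Sum>i\<in>UNIV. (f i)\<^sup>2)"
proof -
  have "frobenius_sq X = trace (X ** transpose X)" for X :: "real^'n^'n"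
    by (simp add: frobenius_sq_def trace_def matrix_matrix_mult_def transpose_def power2_eq_square)
  then have "frobenius_sq (spectral_mat Q f) = trace (spectral_mat Q f ** spectral_mat Q f)"
    using symmetric_spectral_mat[of Q f] by (simp add: symmetric_mat_def)
  then show ?thesis
    by (simp add: spectral_mat_mult[OF assms] trace_spectral_mat[OF assms] power2_eq_square)
qed

lemma mat_pow_spectral_mat:
  assumes "orthogonal_matrix Q"
  shows "mat_pow (spectral_mat Q f) k = spectral_mat Q (\<lambda>i. f i ^ k)"
proof (induction k)
  case 0
  then show ?case by (simp add: mat_pow_def spectral_mat_one[OF assms])
next
  case (Suc k)
  then show ?case by (simp add: mat_pow_def spectral_mat_mult[OF assms])
qed

text \<open>
  Convergence is checked entry by entry, where the series is a finite linear combination of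
  scalar exponential series.
\<close>

lemma mat_exp_spectral_mat:
  assumes "orthogonal_matrix Q"
  shows "mat_exp (spectral_mat Q f) = spectral_mat Q (\<lambda>i. exp (f i))"
proof -
  have "(\<lambda>k. ((1 / fact k) *\<^sub>R mat_pow (spectral_mat Q f) k) $ i $ j)
          sums (spectral_mat Q (\<lambda>i. exp (f i)) $ i $ j)" for i j
  proof -
    have "(\<lambda>k. \<Sum>l\<in>UNIV. Q $ i $ l * (f l ^ k /\<^sub>R fact k) * Q $ j $ l)
            sums (\<Sum>l\<in>UNIV. Q $ i $ l * exp (f l) * Q $ j $ l)"
      by (intro sums_sum sums_mult sums_mult2 exp_converges)
    then show ?thesis
      by (simp add: mat_pow_spectral_mat[OF assms] spectral_mat_nth sum_distrib_left divide_inverse mult_ac)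
  qed
  then have "(\<lambda>k. (1 / fact k) *\<^sub>R mat_pow (spectral_mat Q f) k) sums spectral_mat Q (\<lambda>i. exp (f i))"
    unfolding sums_def by (intro vec_tendstoI) (simp only: sum_component)
  then show ?thesis
    by (simp add: mat_exp_def sums_iff)
qed

text \<open>
  Injectivity of \<open>exp\<close> on symmetric matrices. Two diagonalizations represent the same matrix iff
  \<open>f i * S $ i $ j = S $ i $ j * g j\<close> for the change of basis \<open>S\<close>, that is, iff \<open>f i = g j\<close> wherever
  \<open>S $ i $ j \<noteq> 0\<close>. This condition is not affected by applying the injective scalar \<open>exp\<close> to both
  \<open>f\<close> and \<open>g\<close>.
\<close>

lemma spectral_mat_exp_inj:
  assumes Q: "orthogonal_matrix Q" and R: "orthogonal_matrix R"
    and eq: "spectral_mat Q (\<lambda>i. exp (d i)) = spectral_mat R (\<lambda>i. exp (e i))"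
  shows "spectral_mat Q d = spectral_mat R e"
proof -
  define S where "S = transpose Q ** R"
  have intertwine: "spectral_mat Q f = spectral_mat R g \<longleftrightarrow> (\<forall>i j. f i * S $ i $ j = S $ i $ j * g j)" for f g
  proof -
    have "spectral_mat Q f = spectral_mat R g \<longleftrightarrow> diag_mat f ** S = S ** diag_mat g"
    proof
      assume *: "spectral_mat Q f = spectral_mat R g"
      have "diag_mat f ** S = transpose Q ** spectral_mat Q f ** R"
        using Q by (simp add: S_def spectral_mat_def orthogonal_matrix_def matrix_mul_assoc)
      also have "\<dots> = transpose Q ** R ** diag_mat g ** (transpose R ** R)"
        unfolding * by (simp add: spectral_mat_def matrix_mul_assoc)
      finally show "diag_mat f ** S = S ** diag_mat g"
        using R by (simp add: S_def orthogonal_matrix_def)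
    next
      assume *: "diag_mat f ** S = S ** diag_mat g"
      have "spectral_mat Q f = Q ** (diag_mat f ** S) ** transpose R"
        using R by (simp add: S_def spectral_mat_def orthogonal_matrix_def flip: matrix_mul_assoc)
      also have "\<dots> = (Q ** transpose Q) ** R ** diag_mat g ** transpose R"
        unfolding * by (simp add: S_def matrix_mul_assoc)
      finally show "spectral_mat Q f = spectral_mat R g"
        using Q by (simp add: spectral_mat_def orthogonal_matrix_def)
    qed
    then show ?thesis
      by (simp add: vec_eq_iff diag_mat_mult mult_diag_mat)
  qed
  then show ?thesis
    using eq by auto
qed

lemma mat_log_spectral_mat:
  assumes "orthogonal_matrix Q"
  shows "mat_log (spectral_mat Q (\<lambda>i. exp (d i))) = spectral_mat Q d"
  unfolding mat_log_def
proof (rule the_equality)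
  fix X assume X: "symmetric_mat X \<and> mat_exp X = spectral_mat Q (\<lambda>i. exp (d i))"
  then obtain R e where R: "orthogonal_matrix R" and e: "X = spectral_mat R e"
    using symmetric_mat_spectral by blast
  have "spectral_mat R (\<lambda>i. exp (e i)) = spectral_mat Q (\<lambda>i. exp (d i))"
    using X unfolding e mat_exp_spectral_mat[OF R] by blast
  then show "X = spectral_mat Q d"
    unfolding e by (rule spectral_mat_exp_inj[OF R assms])
qed (intro conjI symmetric_spectral_mat mat_exp_spectral_mat[OF assms])

lemma spd_mat_spectral:
  fixes P :: "real^'n^'n"
  assumes "spd_mat P"
  obtains Q a where "orthogonal_matrix Q" "\<And>i. a i > 0" "P = spectral_mat Q a"
    "mat_log P = spectral_mat Q (\<lambda>i. ln (a i))"
proof -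
  obtain Q a where Q: "orthogonal_matrix Q" and P: "P = spectral_mat Q a"
    using assms symmetric_mat_spectral unfolding spd_mat_def by blast
  have a: "a i > 0" for i
  proof -
    have "P ** Q = Q ** diag_mat a"
      using Q by (simp add: P spectral_mat_def orthogonal_matrix_def flip: matrix_mul_assoc)
    then have "P *v column i Q = a i *\<^sub>R column i Q"
      by (simp add: vec_eq_iff matrix_matrix_mult_def matrix_vector_mult_def column_def mult_ac diag_mat_def
          if_distrib cong: if_cong)
    moreover have "norm (column i Q) = 1"
      using Q by (simp add: orthogonal_matrix_orthonormal_columns)
    moreover from this have "0 < column i Q \<bullet> (P *v column i Q)"
      using assms unfolding spd_mat_def by (metis norm_zero zero_neq_one)
    ultimately show ?thesis
      by (simp add: dot_square_norm)
  qed
  moreover have "mat_log P = spectral_mat Q (\<lambda>i. ln (a i))"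
    using mat_log_spectral_mat[OF Q, of "\<lambda>i. ln (a i)"] a by (simp add: P)
  ultimately show ?thesis
    using Q P that by blast
qed

section \<open>The inequality in dimensions two and three\<close>

text \<open>
  Compare the two polynomials in \<open>t\<close> coefficient by coefficient. The hypothesis \<open>e2\<close> concerns the
  elementary symmetric polynomial of degree \<open>n - 1\<close>: for \<open>n = 3\<close> this is the coefficient of \<open>t\<close>,
  while for \<open>n = 2\<close> it is again the sum.
\<close>

lemma prod_shift_mono_dim_2_3:
  fixes a b :: "'n::finite \<Rightarrow> real"
  assumes card: "CARD('n) = 2 \<or> CARD('n) = 3"
    and pos: "\<And>i. a i > 0" "\<And>i. b i > 0"
    and e1: "sum b UNIV \<le> sum a UNIV"
    and e2: "prod b UNIV * (\<Sum>i\<in>UNIV. 1 / b i) \<le> prod a UNIV * (\<Sum>i\<in>UNIV. 1 / a i)"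
    and e3: "prod b UNIV = prod a UNIV"
    and t: "t \<ge> 0"
  shows "(\<Prod>i\<in>UNIV. t + b i) \<le> (\<Prod>i\<in>UNIV. t + a i)"
  using card
proof
  assume "CARD('n) = 2"
  then obtain x y :: 'n where U: "UNIV = {x, y}" "x \<noteq> y"
    by (auto simp: card_2_iff)
  have expand: "(\<Prod>i\<in>UNIV. t + c i) = t\<^sup>2 + t * sum c UNIV + prod c UNIV" for c :: "'n \<Rightarrow> real"
    unfolding U(1) using U(2) by (simp add: power2_eq_square algebra_simps)
  show ?thesis
    unfolding expand using e1 e3 t by (simp add: mult_left_mono)
next
  assume "CARD('n) = 3"
  then obtain x y z :: 'n where U: "UNIV = {x, y, z}" "x \<noteq> y" "y \<noteq> z" "x \<noteq> z"
    by (auto simp: card_3_iff)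
  have expand: "(\<Prod>i\<in>UNIV. t + c i)
      = t ^ 3 + t\<^sup>2 * sum c UNIV + t * (prod c UNIV * (\<Sum>i\<in>UNIV. 1 / c i)) + prod c UNIV"
    if "\<And>i. c i > 0" for c :: "'n \<Rightarrow> real"
    unfolding U(1) using U(2-4) that[THEN less_imp_neq, THEN not_sym]
    by (simp add: power2_eq_square power3_eq_cube field_simps)
  show ?thesis
    unfolding expand[of a, OF pos(1)] expand[of b, OF pos(2)] using e1 e2 e3 t
    by (intro add_mono mult_left_mono) auto
qed

theorem theorem1:
  fixes P1 P2 :: "real^'n^'n"
  assumes "CARD('n) = 2 \<or> CARD('n) = 3"
    and "spd_mat P1" and "spd_mat P2"
    and "trace P1 \<ge> trace P2"
    and "trace (cof_mat P1) \<ge> trace (cof_mat P2)"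
    and "det P1 = det P2"
  shows "frobenius_sq (mat_log P1) \<ge> frobenius_sq (mat_log P2)"
proof -
  obtain Q a where a: "orthogonal_matrix Q" "\<And>i. a i > 0" "P1 = spectral_mat Q a"
    "mat_log P1 = spectral_mat Q (\<lambda>i. ln (a i))"
    using spd_mat_spectral[OF assms(2)] by metis
  obtain R b where b: "orthogonal_matrix R" "\<And>i. b i > 0" "P2 = spectral_mat R b"
    "mat_log P2 = spectral_mat R (\<lambda>i. ln (b i))"
    using spd_mat_spectral[OF assms(3)] by metis
  have nz: "a i \<noteq> 0" "b i \<noteq> 0" for i
    using a(2)[of i] b(2)[of i] by auto
  have e1: "sum b UNIV \<le> sum a UNIV"
    using assms(4) by (simp add: a b trace_spectral_mat)
  have e2: "prod b UNIV * (\<Sum>i\<in>UNIV. 1 / b i) \<le> prod a UNIV * (\<Sum>i\<in>UNIV. 1 / a i)"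
    using assms(5) by (simp add: a(1,3) b(1,3) trace_cof_spectral_mat nz)
  have e3: "prod b UNIV = prod a UNIV"
    using assms(6) by (simp add: a(1,3) b(1,3) det_spectral_mat)
  have "(\<Sum>i\<in>UNIV. (ln (b i))\<^sup>2) \<le> (\<Sum>i\<in>UNIV. (ln (a i))\<^sup>2)"
    using a(2) b(2) e1 e2 e3
    by (intro sum_ln_squared_mono prod_shift_mono_dim_2_3[OF assms(1)]) auto
  then show ?thesis
    by (simp add: a(1,4) b(1,4) frobenius_sq_spectral_mat)
qed

end
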